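(* Every monotone map $\mathbf{f}:X\to\mathbb{R}^k$ (on a non-empty semi-monotone set $X\subset\mathbb{R}^n$) is quasi-affine.
   Context: Fix an o-minimal structure over $\mathbb{R}$; all sets and maps are definable. The empty set is connected. A coordinate cone in $\mathbb{R}^N$ is a set $\{z\mid z_{j_1}\sigma_1c_1,\dots,z_{j_m}\sigma_mc_m\}$ ($0\le m\le N$, distinct indices, $\sigma_i\in\{<,=,>\}$, $c_i\in\mathbb{R}$). A set is semi-monotone if it is open, bounded, definable and meets every coordinate cone in a connected set. A definable $f$ on open $X\subset\mathbb{R}^n$ is strictly increasing/decreasing in $x_j$ if $f(\mathbf{x})<f(\mathbf{y})$ / $f(\mathbf{x})>f(\mathbf{y})$ whenever $\mathbf{x},\mathbf{y}\in X$ differ only in coordinate $j$ with $x_j<y_j$, and independent of $x_j$ if $f(\mathbf{x})=f(\mathbf{y})$ for such pairs. A bounded upper semicontinuous $f$ on non-empty semi-monotone $X$ is submonotone if all $\{f<b\}$ are semi-monotone, supermonotone if $-f$ is submonotone; $f$ is a monotone function if it is sub- and supermonotone and for each $j$ strictly increasing in, strictly decreasing in, or independent of $x_j$. For $X\subset\mathbb{R}^n$ non-empty semi-monotone and $\mathbf{f}=(f_1,\dots,f_k):X\to\mathbb{R}^k$ continuous bounded with graph $\mathbf{F}$ (coordinates $x_1,\dots,x_n,y_1,\dots,y_k$), a set $\{x_{j_1},\dots,x_{j_\alpha},y_{i_1},\dots,y_{i_\beta}\}$ with $\alpha+\beta=n$ is a basis set if $(x_{j_1},\dots,x_{j_\alpha},f_{i_1},\dots,f_{i_\beta}):X\to\mathbb{R}^n$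 is injective. $\mathbf{f}$ is a monotone map, by induction on $n$: for $n=1$ if each $f_i$ is a monotone function; for $n>1$ if for all $i,j$ with $f_i$ not independent of $x_j$: (i) each non-empty $\mathbf{F}\cap\{y_i=b\}$ (viewed in the coordinates other than $y_i$) is the graph of a monotone map $\mathbf{f}_{i,j,b}$ from a semi-monotone subset of the span of $\{x_1,\dots,x_n\}\setminus\{x_j\}$ to the span of $y_1,\dots,y_{i-1},x_j,y_{i+1},\dots,y_k$; (ii) the system of basis sets of $\mathbf{f}_{i,j,b}$ is independent of $b$. A bounded continuous map $\mathbf{f}$ on an open bounded non-empty $X\subset\mathbb{R}^n$ with graph $\mathbf{F}\subset\mathbb{R}^{n+k}$ is quasi-affine if for every $T=\mathrm{span}\{x_{j_1},\dots,x_{j_\alpha},y_{i_1},\dots,y_{i_\beta}\}$ with $\alpha+\beta=n$, the coordinate projection $\rho_T:\mathbf{F}\to T$ is injective if and only if $\rho_T(\mathbf{F})$ is $n$-dimensional. *)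

theory Defs
  imports "HOL-Analysis.Analysis"
begin

text \<open>
  The recursion defining monotone maps exchanges a domain coordinate with a target coordinate.
  Euclidean spaces are therefore indexed by finite sets of coordinate labels: for a finite set
  \<open>I\<close> the space $\mathbb{R}^I$ is \<open>I \<rightarrow>\<^sub>E UNIV\<close>, the carrier of the product topology
  \<open>powertop_real I\<close>.  Restricting a point to \<open>T \<subseteq> I\<close> is the coordinate projection to the
  span of \<open>T\<close>.
\<close>

abbreviation RR :: "'i set \<Rightarrow> ('i \<Rightarrow> real) set" where
  "RR I \<equiv> I \<rightarrow>\<^sub>E UNIV"

datatype coord = XC nat | YC nat


section \<open>O-minimal structures and definability\<close>

text \<open>
  This is van den Dries' notion of an o-minimal structure on \<open>(\<real>, <)\<close>; addition and
  multiplication are not required to be definable, but they may be.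
\<close>

type_synonym set_family = "nat \<Rightarrow> (nat \<Rightarrow> real) set set"

definition o_minimal :: "set_family \<Rightarrow> bool" where
  "o_minimal S \<longleftrightarrow>
     (\<forall>n. S n \<subseteq> Pow (RR {..<n}) \<and> {} \<in> S n
        \<and> (\<forall>A\<in>S n. RR {..<n} - A \<in> S n) \<and> (\<forall>A\<in>S n. \<forall>B\<in>S n. A \<union> B \<in> S n))
   \<and> (\<forall>n. \<forall>A\<in>S n.
        {z \<in> RR {..<Suc n}. restrict z {..<n} \<in> A} \<in> S (Suc n)
      \<and> {z \<in> RR {..<Suc n}. (\<lambda>m\<in>{..<n}. z (Suc m)) \<in> A} \<in> S (Suc n))
   \<and> (\<forall>n\<ge>1. {z \<in> RR {..<n}. z 0 = z (n - 1)} \<in> S n)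
   \<and> (\<forall>n. \<forall>A\<in>S (Suc n). (\<lambda>z. restrict z {..<n}) ` A \<in> S n)
   \<and> {z \<in> RR {..<2}. z 0 < z 1} \<in> S 2
   \<and> (\<forall>A. A \<in> S 1 \<longleftrightarrow>
        (\<exists>\<J> :: real set set. finite \<J> \<and> (\<forall>J\<in>\<J>. is_interval J)
           \<and> A = {z \<in> RR {..<1}. z 0 \<in> \<Union>\<J>}))"

definition reindex :: "(nat \<Rightarrow> 'i) \<Rightarrow> nat \<Rightarrow> ('i \<Rightarrow> real) \<Rightarrow> (nat \<Rightarrow> real)" where
  "reindex e n z = (\<lambda>m\<in>{..<n}. z (e m))"

text \<open>
  The axioms make each \<open>S n\<close> invariant under permutations of the coordinates, so the choice
  of the enumeration \<open>e\<close> is immaterial.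
\<close>

definition definable :: "set_family \<Rightarrow> 'i set \<Rightarrow> ('i \<Rightarrow> real) set \<Rightarrow> bool" where
  "definable S I A \<longleftrightarrow> finite I \<and> A \<subseteq> RR I
     \<and> (\<exists>e. bij_betw e {..<card I} I \<and> reindex e (card I) ` A \<in> S (card I))"

text \<open>
  The graph of a real function on a subset of $\mathbb{R}^I$ lives in one more coordinate,
  labelled \<open>None\<close>: \<open>case_option (f x) x\<close> is the point with coordinates \<open>x i\<close> at \<open>Some i\<close>
  and \<open>f x\<close> at \<open>None\<close>.
\<close>

definition definable_fun ::
  "set_family \<Rightarrow> 'i set \<Rightarrow> ('i \<Rightarrow> real) set \<Rightarrow> (('i \<Rightarrow> real) \<Rightarrow> real) \<Rightarrow> bool" where
  "definable_fun S I X f \<longleftrightarrow>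
     definable S (insert None (Some ` I)) ((\<lambda>x. case_option (f x) x) ` X)"


section \<open>Cells and dimension\<close>

definition cell_bound ::
  "set_family \<Rightarrow> nat \<Rightarrow> (nat \<Rightarrow> real) set \<Rightarrow> ((nat \<Rightarrow> real) \<Rightarrow> ereal) \<Rightarrow> bool" where
  "cell_bound S n C h \<longleftrightarrow>
     (\<forall>x\<in>C. h x = -\<infinity>) \<or> (\<forall>x\<in>C. h x = \<infinity>)
   \<or> (\<exists>g. definable_fun S {..<n} C g
        \<and> continuous_map (subtopology (powertop_real {..<n}) C) euclideanreal g
        \<and> (\<forall>x\<in>C. h x = ereal (g x)))"

text \<open>\<open>cell S n d C\<close>: \<open>C\<close> is an $(i_1,\dots,i_n)$-cell with $i_1+\dots+i_n = d$.\<close>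

inductive cell :: "set_family \<Rightarrow> nat \<Rightarrow> nat \<Rightarrow> (nat \<Rightarrow> real) set \<Rightarrow> bool" for S where
  point: "cell S 0 0 (RR {..<0})"
| graph: "\<lbrakk> cell S n d C; definable_fun S {..<n} C f;
           continuous_map (subtopology (powertop_real {..<n}) C) euclideanreal f \<rbrakk>
         \<Longrightarrow> cell S (Suc n) d {x(n := f x) | x. x \<in> C}"
| band: "\<lbrakk> cell S n d C; cell_bound S n C l; cell_bound S n C u; \<forall>x\<in>C. l x < u x \<rbrakk>
         \<Longrightarrow> cell S (Suc n) (Suc d)
               {x(n := t) | x t. x \<in> C \<and> l x < ereal t \<and> ereal t < u x}"

definition contains_cell :: "set_family \<Rightarrow> 'i set \<Rightarrow> ('i \<Rightarrow> real) set \<Rightarrow> nat \<Rightarrow> bool" where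
  "contains_cell S I A d \<longleftrightarrow>
     (\<exists>e C. bij_betw e {..<card I} I \<and> cell S (card I) d C \<and> C \<subseteq> reindex e (card I) ` A)"

text \<open>
  The dimension of a definable set is the largest dimension of a cell contained in it.  It is
  given as a relation, so that the empty set has no dimension.
\<close>

definition has_dim :: "set_family \<Rightarrow> 'i set \<Rightarrow> ('i \<Rightarrow> real) set \<Rightarrow> nat \<Rightarrow> bool" where
  "has_dim S I A d \<longleftrightarrow> definable S I A \<and> contains_cell S I A d
     \<and> (\<forall>d'. contains_cell S I A d' \<longrightarrow> d' \<le> d)"


section \<open>Semi-monotone sets\<close>

definition coordinate_cone :: "'i set \<Rightarrow> ('i \<Rightarrow> real) set \<Rightarrow> bool" where
  "coordinate_cone I C \<longleftrightarrow>
     (\<exists>J \<sigma> c. J \<subseteq> I \<and> (\<forall>j\<in>J. \<sigma> j \<in> {(<), (=), (>)})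
        \<and> C = {z \<in> RR I. \<forall>j\<in>J. \<sigma> j (z j) (c j)})"

definition bounded_on :: "'i set \<Rightarrow> ('i \<Rightarrow> real) set \<Rightarrow> bool" where
  "bounded_on I A \<longleftrightarrow> (\<exists>M. \<forall>z\<in>A. \<forall>i\<in>I. \<bar>z i\<bar> \<le> M)"

definition semi_monotone :: "set_family \<Rightarrow> 'i set \<Rightarrow> ('i \<Rightarrow> real) set \<Rightarrow> bool" where
  "semi_monotone S I X \<longleftrightarrow>
     openin (powertop_real I) X \<and> bounded_on I X \<and> definable S I X
   \<and> (\<forall>C. coordinate_cone I C \<longrightarrow> connectedin (powertop_real I) (X \<inter> C))"


section \<open>Monotone functions\<close>

definition differ_only :: "'i set \<Rightarrow> 'i \<Rightarrow> ('i \<Rightarrow> real) \<Rightarrow> ('i \<Rightarrow> real) \<Rightarrow> bool" where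
  "differ_only I j x y \<longleftrightarrow> (\<forall>i\<in>I - {j}. x i = y i) \<and> x j < y j"

definition strictly_increasing_in ::
  "'i set \<Rightarrow> ('i \<Rightarrow> real) set \<Rightarrow> (('i \<Rightarrow> real) \<Rightarrow> real) \<Rightarrow> 'i \<Rightarrow> bool" where
  "strictly_increasing_in I X f j \<longleftrightarrow> (\<forall>x\<in>X. \<forall>y\<in>X. differ_only I j x y \<longrightarrow> f x < f y)"

definition strictly_decreasing_in ::
  "'i set \<Rightarrow> ('i \<Rightarrow> real) set \<Rightarrow> (('i \<Rightarrow> real) \<Rightarrow> real) \<Rightarrow> 'i \<Rightarrow> bool" where
  "strictly_decreasing_in I X f j \<longleftrightarrow> (\<forall>x\<in>X. \<forall>y\<in>X. differ_only I j x y \<longrightarrow> f x > f y)"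

definition independent_of ::
  "'i set \<Rightarrow> ('i \<Rightarrow> real) set \<Rightarrow> (('i \<Rightarrow> real) \<Rightarrow> real) \<Rightarrow> 'i \<Rightarrow> bool" where
  "independent_of I X f j \<longleftrightarrow> (\<forall>x\<in>X. \<forall>y\<in>X. differ_only I j x y \<longrightarrow> f x = f y)"

text \<open>
  Definability of the function itself is demanded once, in \<open>monotone_function\<close>: negation need
  not be definable, so it must not be asked of \<open>- f\<close> in \<open>supermonotone\<close>.
\<close>

definition submonotone ::
  "set_family \<Rightarrow> 'i set \<Rightarrow> ('i \<Rightarrow> real) set \<Rightarrow> (('i \<Rightarrow> real) \<Rightarrow> real) \<Rightarrow> bool" where
  "submonotone S I X f \<longleftrightarrow>
     X \<noteq> {} \<and> semi_monotone S I X \<and> bounded (f ` X)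
   \<and> (\<forall>b. openin (subtopology (powertop_real I) X) {x \<in> X. f x < b}) \<comment> \<open>upper semicontinuity\<close>
   \<and> (\<forall>b. semi_monotone S I {x \<in> X. f x < b})"

definition supermonotone ::
  "set_family \<Rightarrow> 'i set \<Rightarrow> ('i \<Rightarrow> real) set \<Rightarrow> (('i \<Rightarrow> real) \<Rightarrow> real) \<Rightarrow> bool" where
  "supermonotone S I X f \<longleftrightarrow> submonotone S I X (\<lambda>x. - f x)"

definition monotone_function ::
  "set_family \<Rightarrow> 'i set \<Rightarrow> ('i \<Rightarrow> real) set \<Rightarrow> (('i \<Rightarrow> real) \<Rightarrow> real) \<Rightarrow> bool" where
  "monotone_function S I X f \<longleftrightarrow>
     definable_fun S I X f \<and> submonotone S I X f \<and> supermonotone S I X f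
   \<and> (\<forall>j\<in>I. strictly_increasing_in I X f j \<or> strictly_decreasing_in I X f j
             \<or> independent_of I X f j)"


section \<open>Monotone maps and quasi-affine maps\<close>

text \<open>
  Below \<open>A\<close> is the set of domain coordinates, \<open>B\<close> (disjoint from \<open>A\<close>) the set of target
  coordinates, and \<open>f\<close> maps \<open>X \<subseteq> RR A\<close> to \<open>RR B\<close>.  Thus \<open>merge A B (x, f x)\<close> is the point
  of the graph above \<open>x\<close>, a member of \<open>RR (A \<union> B)\<close>.
\<close>

definition graph_of ::
  "'i set \<Rightarrow> 'i set \<Rightarrow> ('i \<Rightarrow> real) set \<Rightarrow> (('i \<Rightarrow> real) \<Rightarrow> ('i \<Rightarrow> real)) \<Rightarrow> ('i \<Rightarrow> real) set" where
  "graph_of A B X f = (\<lambda>x. merge A B (x, f x)) ` X"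

definition bounded_continuous_definable_map ::
  "set_family \<Rightarrow> 'i set \<Rightarrow> 'i set \<Rightarrow> ('i \<Rightarrow> real) set \<Rightarrow> (('i \<Rightarrow> real) \<Rightarrow> ('i \<Rightarrow> real)) \<Rightarrow> bool" where
  "bounded_continuous_definable_map S A B X f \<longleftrightarrow>
     continuous_map (subtopology (powertop_real A) X) (powertop_real B) f
   \<and> bounded_on B (f ` X) \<and> definable S (A \<union> B) (graph_of A B X f)"

definition basis_sets ::
  "'i set \<Rightarrow> 'i set \<Rightarrow> ('i \<Rightarrow> real) set \<Rightarrow> (('i \<Rightarrow> real) \<Rightarrow> ('i \<Rightarrow> real)) \<Rightarrow> 'i set set" where
  "basis_sets A B X f =
     {T. T \<subseteq> A \<union> B \<and> card T = card A \<and> inj_on (\<lambda>x. restrict (merge A B (x, f x)) T) X}"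

definition slice :: "'i set \<Rightarrow> ('i \<Rightarrow> real) set \<Rightarrow> 'i \<Rightarrow> real \<Rightarrow> ('i \<Rightarrow> real) set" where
  "slice I F i b = {restrict z (I - {i}) | z. z \<in> F \<and> z i = b}"

text \<open>
  In the rule \<open>step\<close>, \<open>g b\<close> on \<open>Y b\<close> is the map $\mathbf{f}_{i,j,b}$, defined for those \<open>b\<close>
  for which the slice is non-empty.  That \<open>Y b\<close> is semi-monotone is part of \<open>g b\<close> being a
  monotone map.
\<close>

inductive is_monotone_map ::
  "set_family \<Rightarrow> 'i set \<Rightarrow> 'i set \<Rightarrow> ('i \<Rightarrow> real) set \<Rightarrow> (('i \<Rightarrow> real) \<Rightarrow> ('i \<Rightarrow> real)) \<Rightarrow> bool"
  for S where
  one: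
    "\<lbrakk> card A = 1; X \<noteq> {}; semi_monotone S A X; bounded_continuous_definable_map S A B X f;
       \<forall>i\<in>B. monotone_function S A X (\<lambda>x. f x i) \<rbrakk>
     \<Longrightarrow> is_monotone_map S A B X f"
| step:
    "\<lbrakk> card A > 1; X \<noteq> {}; semi_monotone S A X; bounded_continuous_definable_map S A B X f;
       \<forall>i\<in>B. \<forall>j\<in>A. \<not> independent_of A X (\<lambda>x. f x i) j \<longrightarrow>
         (\<exists>Y g.
            (\<forall>b. slice (A \<union> B) (graph_of A B X f) i b \<noteq> {} \<longrightarrow>
               slice (A \<union> B) (graph_of A B X f) i b
                 = graph_of (A - {j}) (insert j (B - {i})) (Y b) (g b)
             \<and> is_monotone_map S (A - {j}) (insert j (B - {i})) (Y b) (g b))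
          \<and> (\<forall>b b'. slice (A \<union> B) (graph_of A B X f) i b \<noteq> {}
                 \<and> slice (A \<union> B) (graph_of A B X f) i b' \<noteq> {} \<longrightarrow>
               basis_sets (A - {j}) (insert j (B - {i})) (Y b) (g b)
                 = basis_sets (A - {j}) (insert j (B - {i})) (Y b') (g b'))) \<rbrakk>
     \<Longrightarrow> is_monotone_map S A B X f"

definition quasi_affine ::
  "set_family \<Rightarrow> 'i set \<Rightarrow> 'i set \<Rightarrow> ('i \<Rightarrow> real) set \<Rightarrow> (('i \<Rightarrow> real) \<Rightarrow> ('i \<Rightarrow> real)) \<Rightarrow> bool" where
  "quasi_affine S A B X f \<longleftrightarrow>
     X \<noteq> {} \<and> openin (powertop_real A) X \<and> bounded_on A X \<and> definable S A X
   \<and> bounded_continuous_definable_map S A B X f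
   \<and> (\<forall>T. T \<subseteq> A \<union> B \<and> card T = card A \<longrightarrow>
        (inj_on (\<lambda>z. restrict z T) (graph_of A B X f)
         \<longleftrightarrow> has_dim S T ((\<lambda>z. restrict z T) ` graph_of A B X f) (card A)))"

end

theory Submission
  imports Defs "HOL-Homology.Invariance_of_Domain"
begin

text \<open>
  If \<open>\<rho>\<^sub>T\<close> is injective on the graph, it is a continuous injection of an open
  subset of $\mathbb{R}^n$ into $\mathbb{R}^n$, so its image is open by invariance of domain.

  Conversely, suppose that the image contains an open box, and argue by induction on \<open>n\<close>.  If
  \<open>T\<close> consists of the domain coordinates there is nothing to prove.  Otherwise \<open>T\<close> contains
  some \<open>y\<^sub>i\<close>, and \<open>f\<^sub>i\<close> depends on some \<open>x\<^sub>j\<close>, since it would be constant on the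
  connected set \<open>X\<close> otherwise.  For \<open>b\<close> in the \<open>i\<close>-th side of the box, the projection of the
  slice \<open>y\<^sub>i = b\<close> to \<open>T - {y\<^sub>i}\<close> again contains a box, so by induction \<open>T - {y\<^sub>i}\<close> is
  a basis set of that slice.  As the basis sets do not depend on \<open>b\<close>, the projection is injective
  on every slice, hence on the whole graph.
\<close>

section \<open>Definable sets\<close>

context
  fixes S :: set_family
  assumes S: "o_minimal S"
begin

lemmas om_boolean = S[unfolded o_minimal_def, THEN conjunct1]
lemmas om_cylinder = S[unfolded o_minimal_def, THEN conjunct2, THEN conjunct1]
lemmas om_outer_diagonal = S[unfolded o_minimal_def, THEN conjunct2, THEN conjunct2, THEN conjunct1]
lemmas om_drop_last =
  S[unfolded o_minimal_def, THEN conjunct2, THEN conjunct2, THEN conjunct2, THEN conjunct1]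
lemmas om_line = S[unfolded o_minimal_def, THEN conjunct2, THEN conjunct2, THEN conjunct2,
    THEN conjunct2, THEN conjunct2]

lemma om_subset: "A \<in> S n \<Longrightarrow> A \<subseteq> RR {..<n}"
  using om_boolean by blast

lemma om_Diff: "A \<in> S n \<Longrightarrow> RR {..<n} - A \<in> S n"
  using om_boolean by blast

lemma om_Un: "A \<in> S n \<Longrightarrow> B \<in> S n \<Longrightarrow> A \<union> B \<in> S n"
  using om_boolean by blast

lemma om_UNIV: "RR {..<n} \<in> S n"
proof -
  have "{} \<in> S n"
    using om_boolean by blast
  then show ?thesis
    using om_Diff by fastforce
qed

lemma om_Int:
  assumes "A \<in> S n" "B \<in> S n"
  shows "A \<inter> B \<in> S n"
proof -
  have "A \<inter> B = RR {..<n} - ((RR {..<n} - A) \<union> (RR {..<n} - B))"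
    using om_subset[OF assms(1)] by auto
  then show ?thesis
    using assms om_Diff om_Un by simp
qed

lemma om_INT:
  assumes "finite M" "\<And>m. m \<in> M \<Longrightarrow> {z \<in> RR {..<n}. P m z} \<in> S n"
  shows "{z \<in> RR {..<n}. \<forall>m\<in>M. P m z} \<in> S n"
  using assms
proof (induction M)
  case empty
  then show ?case using om_UNIV by simp
next
  case (insert m M)
  have "{z \<in> RR {..<n}. \<forall>m\<in>insert m M. P m z}
      = {z \<in> RR {..<n}. P m z} \<inter> {z \<in> RR {..<n}. \<forall>m\<in>M. P m z}"
    by auto
  then show ?case
    using insert om_Int by simp
qed

section \<open>Cylinders, projections and selection of coordinates\<close>

lemma om_cylinder_right:
  assumes "A \<in> S n"
  shows "{z \<in> RR {..<n + m}. restrict z {..<n} \<in> A} \<in> S (n + m)"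
proof (induction m)
  case 0
  have "{z \<in> RR {..<n}. restrict z {..<n} \<in> A} = A"
    using om_subset[OF assms] by (auto simp: PiE_restrict subset_iff)
  then show ?case using assms by (simp only: add_0 add_0_right)
next
  case (Suc m)
  have "{z \<in> RR {..<n + Suc m}. restrict z {..<n} \<in> A}
      = {z \<in> RR {..<Suc (n + m)}. restrict z {..<n + m} \<in> {z \<in> RR {..<n + m}. restrict z {..<n} \<in> A}}"
    by (auto simp: Int_absorb1)
  moreover have "\<dots> \<in> S (Suc (n + m))"
    using om_cylinder Suc by blast
  ultimately show ?case by (simp only: add_Suc_right)
qed

lemma om_cylinder_left:
  assumes "A \<in> S n"
  shows "{z \<in> RR {..<m + n}. (\<lambda>l\<in>{..<n}. z (m + l)) \<in> A} \<in> S (m + n)"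
proof (induction m)
  case 0
  have "{z \<in> RR {..<n}. restrict z {..<n} \<in> A} = A"
    using om_subset[OF assms] by (auto simp: PiE_restrict subset_iff)
  then show ?case using assms by (simp only: add_0 add_0_right)
next
  case (Suc m)
  have "{z \<in> RR {..<Suc m + n}. (\<lambda>l\<in>{..<n}. z (Suc m + l)) \<in> A}
      = {z \<in> RR {..<Suc (m + n)}. (\<lambda>l\<in>{..<m + n}. z (Suc l)) \<in>
          {z \<in> RR {..<m + n}. (\<lambda>l\<in>{..<n}. z (m + l)) \<in> A}}"
    by (auto cong: restrict_cong)
  moreover have "\<dots> \<in> S (Suc (m + n))"
    using om_cylinder Suc by blast
  ultimately show ?case by (simp only: add_Suc)
qed

lemma om_projection:
  assumes "A \<in> S (n + m)"
  shows "(\<lambda>z. restrict z {..<n}) ` A \<in> S n"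
  using assms
proof (induction m arbitrary: A)
  case 0
  have "(\<lambda>z. restrict z {..<n}) ` A = A"
    using om_subset[OF 0] by (force simp: PiE_restrict subset_iff image_iff)
  then show ?case using 0 by (simp only: add_0_right)
next
  case (Suc m)
  have "(\<lambda>z. restrict z {..<n + m}) ` A \<in> S (n + m)"
    using om_drop_last Suc.prems by simp
  from Suc.IH[OF this] show ?case
    by (simp add: image_image restrict_restrict Int_absorb1 del: restrict_apply)
qed

text \<open>The axiom only equates the first and the last coordinate. It is applied in dimension
  \<open>j - i + 1\<close>; then \<open>i\<close> coordinates are added in front and
  \<open>n - j - 1\<close> behind.\<close>

lemma om_diagonal:
  assumes "i < j" "j < n"
  shows "{z \<in> RR {..<n}. z i = z j} \<in> S n"
proof -
  define d where "d = j - i"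
  have "{z \<in> RR {..<Suc d}. z 0 = z (Suc d - 1)} \<in> S (Suc d)"
    by (rule om_outer_diagonal[rule_format]) simp
  from om_cylinder_left[OF this, of i]
  have "{z \<in> RR {..<i + Suc d}. z i = z j} \<in> S (i + Suc d)"
    using assms by (simp add: d_def)
  from om_cylinder_right[OF this, of "n - Suc j"] show ?thesis
    using assms by (simp add: d_def)
qed

text \<open>Permutation, repetition and omission of coordinates are all reduced to diagonals and
  projections: \<open>t\<close> fresh coordinates are put in front of a copy of \<open>A\<close>,
  each is equated with the coordinate it selects, and the copy of \<open>A\<close> is projected
  away.\<close>

lemma om_pullback_image:
  assumes "A \<in> S N" "\<And>m. m < t \<Longrightarrow> \<sigma> m < N"
  shows "(\<lambda>y. \<lambda>m\<in>{..<t}. y (\<sigma> m)) ` A \<in> S t"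
proof -
  let ?G = "{z \<in> RR {..<t + N}. (\<lambda>l\<in>{..<N}. z (t + l)) \<in> A}
    \<inter> {z \<in> RR {..<t + N}. \<forall>m\<in>{..<t}. z m = z (t + \<sigma> m)}"
  have "?G \<in> S (t + N)"
    using assms by (intro om_Int om_cylinder_left om_INT om_diagonal) auto
  then have "(\<lambda>z. restrict z {..<t}) ` ?G \<in> S t"
    by (rule om_projection)
  moreover have "(\<lambda>z. restrict z {..<t}) ` ?G = (\<lambda>y. \<lambda>m\<in>{..<t}. y (\<sigma> m)) ` A"
  proof (intro equalityI subsetI)
    fix w assume "w \<in> (\<lambda>z. restrict z {..<t}) ` ?G"
    then obtain z where z: "z \<in> ?G" "w = restrict z {..<t}" by blast
    have "w = (\<lambda>m\<in>{..<t}. (\<lambda>l\<in>{..<N}. z (t + l)) (\<sigma> m))"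
      using z assms(2) by (auto simp: restrict_def)
    then show "w \<in> (\<lambda>y. \<lambda>m\<in>{..<t}. y (\<sigma> m)) ` A"
      using z by blast
  next
    fix w assume "w \<in> (\<lambda>y. \<lambda>m\<in>{..<t}. y (\<sigma> m)) ` A"
    then obtain y where y: "y \<in> A" "w = (\<lambda>m\<in>{..<t}. y (\<sigma> m))" by blast
    \<comment> \<open>The preimage of \<open>w\<close> is the concatenation of \<open>w\<close> and
      \<open>y\<close>.\<close>
    let ?z = "\<lambda>l\<in>{..<t + N}. if l < t then y (\<sigma> l) else y (l - t)"
    have "(\<lambda>l\<in>{..<N}. ?z (t + l)) = y"
      using om_subset[OF assms(1)] y(1)
      by (fastforce simp: restrict_def PiE_def extensional_def)
    then have "?z \<in> ?G"
      using y assms(2) by auto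
    moreover have "w = restrict ?z {..<t}"
      using y by (auto simp: restrict_def)
    ultimately show "w \<in> (\<lambda>z. restrict z {..<t}) ` ?G" by blast
  qed
  ultimately show ?thesis by simp
qed

lemma definable_restrict_image:
  assumes "definable S I A" "T \<subseteq> I"
  shows "definable S T ((\<lambda>z. restrict z T) ` A)"
proof -
  have fin: "finite I" "finite T" and "A \<subseteq> RR I"
    using assms finite_subset unfolding definable_def by auto
  obtain e where e: "bij_betw e {..<card I} I" "reindex e (card I) ` A \<in> S (card I)"
    using assms(1) unfolding definable_def by blast
  obtain e' where e': "bij_betw e' {..<card T} T"
    using ex_bij_betw_nat_finite[OF fin(2)] by (auto simp: atLeast0LessThan)
  \<comment> \<open>\<open>\<sigma> m\<close> is the position in the enumeration \<open>e\<close> of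
    \<open>I\<close> of the \<open>m\<close>-th element of \<open>T\<close>. In these terms
    restriction to \<open>T\<close> becomes a selection of coordinates.\<close>
  define \<sigma> where "\<sigma> m = inv_into {..<card I} e (e' m)" for m
  have \<sigma>: "\<sigma> m < card I" "e (\<sigma> m) = e' m" "e' m \<in> T" if "m < card T" for m
  proof -
    show "e' m \<in> T"
      using e' that by (auto simp: bij_betw_def)
    then have "e' m \<in> e ` {..<card I}"
      using e(1) assms(2) by (auto simp: bij_betw_def)
    then show "\<sigma> m < card I" "e (\<sigma> m) = e' m"
      unfolding \<sigma>_def using inv_into_into[of "e' m" e "{..<card I}"] by (auto simp: f_inv_into_f)
  qed
  have "reindex e' (card T) ` (\<lambda>z. restrict z T) ` A
      = (\<lambda>y. \<lambda>m\<in>{..<card T}. y (\<sigma> m)) ` reindex e (card I) ` A"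
    unfolding image_image reindex_def
    by (intro image_cong refl ext) (auto simp: restrict_def \<sigma>)
  moreover have "\<dots> \<in> S (card T)"
    using e(2) \<sigma> by (intro om_pullback_image) auto
  ultimately show ?thesis
    using fin e' unfolding definable_def by auto
qed

section \<open>Intervals, constants and open boxes\<close>

lemma om_last_coordinate_interval:
  assumes "is_interval (J :: real set)"
  shows "{z \<in> RR {..<Suc n}. z n \<in> J} \<in> S (Suc n)"
proof -
  have "{z \<in> RR {..<1}. z 0 \<in> J} \<in> S 1"
    unfolding om_line[rule_format] using assms by (intro exI[of _ "{J}"]) simp
  from om_cylinder_left[OF this, of n] show ?thesis
    by (simp cong: conj_cong)
qed

text \<open>Constants serve as the bounds of a box viewed as an iterated band. The graph is the
  cylinder over \<open>C\<close> cut by the condition that the last coordinate is \<open>c\<close>,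
  and a one-point set is an interval.\<close>

lemma definable_fun_const:
  assumes "C \<in> S n"
  shows "definable_fun S {..<n} C (\<lambda>_. c)"
proof -
  let ?I = "insert None (Some ` {..<n})"
  \<comment> \<open>The label \<open>None\<close> of the function value is enumerated last, so that
    the value becomes coordinate \<open>n\<close>.\<close>
  define e where "e m = (if m < n then Some m else None)" for m
  have card: "card ?I = Suc n"
    by (simp add: card_image)
  have bij: "bij_betw e {..<Suc n} ?I"
    unfolding bij_betw_def e_def by (auto simp: inj_on_def less_Suc_eq)
  have sub: "case_option c ` C \<subseteq> RR ?I"
  proof
    fix w assume "w \<in> case_option c ` C"
    then obtain x where "x \<in> RR {..<n}" "w = case_option c x"
      using om_subset[OF assms] by blast
    then show "w \<in> RR ?I"
      by (auto simp: PiE_iff extensional_def split: option.splits)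
  qed
  have "{z \<in> RR {..<Suc n}. restrict z {..<n} \<in> C} \<in> S (Suc n)"
    using om_cylinder_right[OF assms, of 1] by simp
  moreover have "{z \<in> RR {..<Suc n}. z n \<in> {c}} \<in> S (Suc n)"
    by (intro om_last_coordinate_interval) (auto simp: is_interval_1)
  moreover have "reindex e (Suc n) ` case_option c ` C
    = {z \<in> RR {..<Suc n}. restrict z {..<n} \<in> C} \<inter> {z \<in> RR {..<Suc n}. z n \<in> {c}}" (is "?L = ?R")
  proof (intro equalityI subsetI)
    fix w assume "w \<in> ?L"
    then obtain x where x: "x \<in> C" "w = reindex e (Suc n) (case_option c x)" by auto
    have "x \<in> RR {..<n}"
      using x(1) om_subset[OF assms] by blast
    then have "restrict w {..<n} = x"
      unfolding x(2) by (auto simp: reindex_def e_def PiE_def extensional_def restrict_def fun_eq_iff)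
    then show "w \<in> ?R"
      using x by (auto simp: reindex_def e_def)
  next
    fix w assume w: "w \<in> ?R"
    have "w = reindex e (Suc n) (case_option c (restrict w {..<n}))"
      using w by (auto simp: reindex_def e_def PiE_def extensional_def restrict_def fun_eq_iff less_Suc_eq)
    then show "w \<in> ?L"
      using w by blast
  qed
  ultimately have "reindex e (Suc n) ` case_option c ` C \<in> S (Suc n)"
    using om_Int by simp
  then show ?thesis
    unfolding definable_fun_def definable_def card using bij sub by auto
qed

lemma om_open_box: "(\<Pi>\<^sub>E m\<in>{..<n}. {a m<..<b m}) \<in> S n"
proof (induction n)
  case 0
  then show ?case using om_UNIV[of 0] by simp
next
  case (Suc n)
  have "(\<Pi>\<^sub>E m\<in>{..<Suc n}. {a m<..<b m})
     = {z \<in> RR {..<n + 1}. restrict z {..<n} \<in> (\<Pi>\<^sub>E m\<in>{..<n}. {a m<..<b m})}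
       \<inter> {z \<in> RR {..<Suc n}. z n \<in> {a n<..<b n}}" (is "?L = ?R")
  proof (intro equalityI subsetI)
    fix z assume z: "z \<in> ?L"
    have m: "z m \<in> {a m<..<b m}" if "m < Suc n" for m
      using PiE_mem[OF z, of m] that by simp
    moreover have "z \<in> RR {..<Suc n}"
      using z by (simp add: PiE_def)
    ultimately show "z \<in> ?R" by (simp del: greaterThanLessThan_iff)
  next
    fix z assume "z \<in> ?R"
    then have z: "z \<in> RR {..<Suc n}" "z n \<in> {a n<..<b n}"
      "restrict z {..<n} \<in> (\<Pi>\<^sub>E m\<in>{..<n}. {a m<..<b m})"
      by blast+
    have "z m \<in> {a m<..<b m}" if "m < Suc n" for m
      using PiE_mem[OF z(3), of m] z(2) that by (cases "m = n") auto
    with z(1) show "z \<in> ?L" by (auto simp: PiE_def)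
  qed
  then show ?case
    using om_Int om_cylinder_right[OF Suc, of 1] om_last_coordinate_interval[of "{a n<..<b n}" n]
    by (simp add: is_interval_oo)
qed

text \<open>Each side of the box is a band between two constants, so every coordinate contributes
  one to the dimension of the cell.\<close>

lemma cell_open_box:
  assumes "\<And>m. m < n \<Longrightarrow> a m < b m"
  shows "cell S n n (\<Pi>\<^sub>E m\<in>{..<n}. {a m<..<b m})"
  using assms
proof (induction n)
  case 0
  then show ?case using cell.point[of S] by simp
next
  case (Suc n)
  let ?C = "\<Pi>\<^sub>E m\<in>{..<n}. {a m<..<b m}"
  have bound: "cell_bound S n ?C (\<lambda>_. ereal c)" for c
    unfolding cell_bound_def using definable_fun_const[OF om_open_box]
    by (intro disjI2 exI[of _ "\<lambda>_. c"]) simp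
  have "cell S (Suc n) (Suc n)
      {x(n := t) | x t. x \<in> ?C \<and> ereal (a n) < ereal t \<and> ereal t < ereal (b n)}"
    using Suc by (intro cell.band bound) auto
  moreover have "{x(n := t) | x t. x \<in> ?C \<and> ereal (a n) < ereal t \<and> ereal t < ereal (b n)}
      = (\<Pi>\<^sub>E m\<in>{..<Suc n}. {a m<..<b m})" (is "?L = ?R")
  proof (intro equalityI subsetI)
    fix z assume "z \<in> ?R"
    then have "z = (restrict z {..<n})(n := z n) \<and> restrict z {..<n} \<in> ?C \<and> z n \<in> {a n<..<b n}"
      by (auto simp: PiE_iff restrict_def fun_eq_iff extensional_def)
    then have "\<exists>x t. z = x(n := t) \<and> x \<in> ?C \<and> t \<in> {a n<..<b n}" by metis
    then show "z \<in> ?L" by auto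
  qed (auto simp: PiE_iff extensional_def less_Suc_eq)
  ultimately show ?case by simp
qed

end

section \<open>Boxes and full dimension\<close>

text \<open>A new coordinate raises the dimension by at most one. This excludes graphs from the
  construction of cells of full dimension and gives the maximality demanded by
  \<open>has_dim\<close>.\<close>

lemma cell_dim_le: "cell S n d C \<Longrightarrow> d \<le> n"
  by (induction rule: cell.induct) auto

text \<open>A substitute for full dimension that mentions neither cells nor enumerations of the
  labels and passes directly to slices. For empty \<open>I\<close> the box is the single point of
  the zero-dimensional space.\<close>

definition contains_box :: "'i set \<Rightarrow> ('i \<Rightarrow> real) set \<Rightarrow> bool" where
  "contains_box I W \<longleftrightarrow>
     (\<exists>a b. (\<forall>i\<in>I. a i < b i) \<and> (\<Pi>\<^sub>E i\<in>I. {a i<..<b i}) \<subseteq> W)"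

lemma contains_box_mono: "contains_box I V \<Longrightarrow> V \<subseteq> W \<Longrightarrow> contains_box I W"
  unfolding contains_box_def by (meson order_trans)

lemma openin_powertop_real_box:
  assumes "openin (powertop_real I) W" "x \<in> W"
  obtains a b where "x \<in> (\<Pi>\<^sub>E i\<in>I. {a i<..<b i})" "(\<Pi>\<^sub>E i\<in>I. {a i<..<b i}) \<subseteq> W"
proof -
  obtain U where U: "\<And>i. i \<in> I \<Longrightarrow> open (U i)" "x \<in> Pi\<^sub>E I U" "Pi\<^sub>E I U \<subseteq> W"
    using assms unfolding openin_product_topology_alt by fastforce
  have "\<exists>a b. x i \<in> {a<..<b} \<and> {a<..<b} \<subseteq> U i" if i: "i \<in> I" for i
  proof -
    have "x i \<in> U i" using U(2) i by auto
    then obtain e where "e > 0" "ball (x i) e \<subseteq> U i"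
      using openE[OF U(1)[OF i]] by metis
    then have "x i \<in> {x i - e<..<x i + e} \<and> {x i - e<..<x i + e} \<subseteq> U i"
      by (simp add: ball_eq_greaterThanLessThan)
    then show ?thesis by blast
  qed
  then obtain a b where ab: "\<And>i. i \<in> I \<Longrightarrow> x i \<in> {a i<..<b i} \<and> {a i<..<b i} \<subseteq> U i"
    by metis
  show ?thesis
  proof
    show "x \<in> (\<Pi>\<^sub>E i\<in>I. {a i<..<b i})" using ab U(2) by (auto simp: PiE_iff)
    show "(\<Pi>\<^sub>E i\<in>I. {a i<..<b i}) \<subseteq> W" using ab by (intro order_trans[OF PiE_mono U(3)]) simp
  qed
qed

lemma contains_box_if_openin:
  assumes "openin (powertop_real I) W" "W \<noteq> {}"
  shows "contains_box I W"
proof -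
  obtain x where "x \<in> W" using assms by blast
  then obtain a b where ab: "x \<in> (\<Pi>\<^sub>E i\<in>I. {a i<..<b i})" "(\<Pi>\<^sub>E i\<in>I. {a i<..<b i}) \<subseteq> W"
    using openin_powertop_real_box[OF assms(1)] by blast
  have "a i < b i" if "i \<in> I" for i
    using PiE_mem[OF ab(1) that] by simp
  with ab(2) show ?thesis
    unfolding contains_box_def by (intro exI[of _ a] exI[of _ b]) simp
qed

text \<open>The sides of the box are relabelled along the inverse of \<open>e\<close>. As
  \<open>A \<subseteq> RR I\<close>, a point of \<open>A\<close> is recovered from its reindexed
  form: outside \<open>I\<close> it is \<open>undefined\<close>.\<close>

lemma contains_box_reindex:
  assumes "bij_betw e {..<n} I" "contains_box {..<n} (reindex e n ` A)" "A \<subseteq> RR I"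
  shows "contains_box I A"
proof -
  obtain a b where ab: "\<And>m. m < n \<Longrightarrow> a m < b m"
      "(\<Pi>\<^sub>E m\<in>{..<n}. {a m<..<b m}) \<subseteq> reindex e n ` A"
    using assms(2) unfolding contains_box_def by auto
  let ?d = "inv_into {..<n} e"
  have d: "?d i < n" "e (?d i) = i" if "i \<in> I" for i
    using assms(1) that inv_into_into[of i e "{..<n}"] by (auto simp: bij_betw_def f_inv_into_f)
  have e: "e m \<in> I" "?d (e m) = m" if "m < n" for m
    using assms(1) that by (auto simp: bij_betw_def)
  have "(\<Pi>\<^sub>E i\<in>I. {a (?d i)<..<b (?d i)}) \<subseteq> A"
  proof
    fix z assume z: "z \<in> (\<Pi>\<^sub>E i\<in>I. {a (?d i)<..<b (?d i)})"
    have "z (e m) \<in> {a m<..<b m}" if "m < n" for m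
      using z e[OF that] by (metis PiE_mem)
    then have "reindex e n z \<in> (\<Pi>\<^sub>E m\<in>{..<n}. {a m<..<b m})"
      by (auto simp: reindex_def)
    then obtain y where y: "y \<in> A" "reindex e n z = reindex e n y"
      using ab(2) by blast
    have "z i = y i" for i
    proof (cases "i \<in> I")
      case True
      then show ?thesis
        using fun_cong[OF y(2), of "?d i"] d[OF True] by (simp add: reindex_def)
    next
      case False
      then show ?thesis using z y(1) assms(3) by (auto simp: PiE_def extensional_def subset_iff)
    qed
    then show "z \<in> A" using y(1) by (metis ext)
  qed
  then show ?thesis
    unfolding contains_box_def using ab(1) d by (intro exI[of _ "a \<circ> ?d"] exI[of _ "b \<circ> ?d"]) auto
qed

section \<open>Openness of cells of full dimension and comparison with boxes\<close>

lemma continuous_map_restrict_powertop_real: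
  assumes "J \<subseteq> I"
  shows "continuous_map (powertop_real I) (powertop_real J) (\<lambda>z. restrict z J)"
  using assms by (auto simp: continuous_map_componentwise intro: continuous_map_product_coordinates)

text \<open>Every step in the construction of such a cell is a band, since a graph step would need a
  base whose dimension exceeds its number of coordinates. A band with continuous or infinite bounds
  over an open base is open.\<close>

lemma cell_full_dim_openin:
  assumes "cell S n d C" "d = n"
  shows "openin (powertop_real {..<n}) C \<and> C \<noteq> {}"
  using assms
proof (induction rule: cell.induct)
  case point
  then show ?case
    using openin_topspace[of "powertop_real ({} :: nat set)"] by simp
next
  case (graph n d C f)
  then show ?case using cell_dim_le by fastforce
next
  case (band n d C l u)
  let ?P = "powertop_real {..<Suc n}" and ?r = "\<lambda>z :: nat \<Rightarrow> real. restrict z {..<n}"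
  \<comment> \<open>The cylinder over \<open>C\<close>, on which the bounds composed with the
    projection \<open>?r\<close> are continuous or constantly infinite.\<close>
  define D where "D = {z \<in> topspace ?P. ?r z \<in> C}"
  have C: "openin (powertop_real {..<n}) C" "C \<noteq> {}"
    using band by auto
  have r: "continuous_map ?P (powertop_real {..<n}) ?r"
    by (rule continuous_map_restrict_powertop_real) auto
  have D: "openin ?P D"
    unfolding D_def using r C(1) by (rule openin_continuous_map_preimage)
  have CR: "C \<subseteq> RR {..<n}"
    using openin_subset[OF C(1)] by simp
  have rD: "continuous_map (subtopology ?P D) (subtopology (powertop_real {..<n}) C) ?r"
    using r by (auto simp: continuous_map_in_subtopology continuous_map_from_subtopology D_def)
  have last: "continuous_map (subtopology ?P D) euclideanreal (\<lambda>z. z n)"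
    by (intro continuous_map_from_subtopology continuous_map_product_coordinates) auto
  \<comment> \<open>An infinite bound yields all of \<open>D\<close> or the empty set. A finite
    bound \<open>g\<close> yields the points where the continuous function
    \<open>z n - g (?r z)\<close> has a given sign.\<close>
  have below: "openin ?P {z \<in> D. h (?r z) < ereal (z n)}"
    and above: "openin ?P {z \<in> D. ereal (z n) < h (?r z)}" if "cell_bound S n C h" for h
  proof -
    consider "\<forall>x\<in>C. h x = -\<infinity>" | "\<forall>x\<in>C. h x = \<infinity>"
      | g where "continuous_map (subtopology (powertop_real {..<n}) C) euclideanreal g"
          "\<forall>x\<in>C. h x = ereal (g x)"
      using \<open>cell_bound S n C h\<close> unfolding cell_bound_def by blast
    then have "openin ?P {z \<in> D. h (?r z) < ereal (z n)} \<and> openin ?P {z \<in> D. ereal (z n) < h (?r z)}"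
    proof cases
      case 1
      then have eqs: "{z \<in> D. h (?r z) < ereal (z n)} = D" "{z \<in> D. ereal (z n) < h (?r z)} = {}"
        by (auto simp: D_def)
      show ?thesis unfolding eqs using D by simp
    next
      case 2
      then have eqs: "{z \<in> D. h (?r z) < ereal (z n)} = {}" "{z \<in> D. ereal (z n) < h (?r z)} = D"
        by (auto simp: D_def)
      show ?thesis unfolding eqs using D by simp
    next
      case 3
      have diff: "continuous_map (subtopology ?P D) euclideanreal (\<lambda>z. z n - g (?r z))"
        using continuous_map_compose[OF rD 3(1)] last
        by (intro continuous_map_diff) (auto simp: o_def)
      have sets: "openin (subtopology ?P D) {z \<in> topspace (subtopology ?P D). z n - g (?r z) \<in> U}"
        if "open U" for U
        using diff that by (intro openin_continuous_map_preimage) auto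
      have "{z \<in> D. h (?r z) < ereal (z n)}
          = {z \<in> topspace (subtopology ?P D). z n - g (?r z) \<in> {0<..}}"
        "{z \<in> D. ereal (z n) < h (?r z)}
          = {z \<in> topspace (subtopology ?P D). z n - g (?r z) \<in> {..<0}}"
        using 3(2) by (auto simp: D_def)
      then show ?thesis
        using sets[of "{0<..}"] sets[of "{..<0}"] D openin_trans_full by fastforce
    qed
    then show "openin ?P {z \<in> D. h (?r z) < ereal (z n)}"
      "openin ?P {z \<in> D. ereal (z n) < h (?r z)}" by auto
  qed
  have "{x(n := t) | x t. x \<in> C \<and> l x < ereal t \<and> ereal t < u x}
      = {z \<in> D. l (?r z) < ereal (z n)} \<inter> {z \<in> D. ereal (z n) < u (?r z)}" (is "?L = ?R")
  proof (intro equalityI subsetI)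
    fix z assume "z \<in> ?L"
    then obtain x t where z: "z = x(n := t)" "x \<in> C" "l x < ereal t" "ereal t < u x" by blast
    have "?r z = x"
      using z CR by (fastforce simp: restrict_def PiE_def extensional_def)
    moreover have "z \<in> topspace ?P"
      using z CR by (fastforce simp: PiE_def extensional_def)
    ultimately show "z \<in> ?R"
      using z by (auto simp: D_def)
  next
    fix z assume z: "z \<in> ?R"
    have "z = (?r z)(n := z n)"
      using z by (auto simp: D_def PiE_def extensional_def restrict_def)
    then show "z \<in> ?L" using z by (auto simp: D_def)
  qed
  moreover have "?L \<noteq> {}"
  proof -
    obtain x where "x \<in> C" using C(2) by blast
    moreover from this obtain t where "l x < ereal t" "ereal t < u x"
      using band.hyps ereal_dense2 by blast
    ultimately show ?thesis by blast
  qed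
  ultimately show ?case
    using openin_Int[OF below[OF band.hyps(2)] above[OF band.hyps(3)]] by simp
qed

lemma contains_box_if_has_dim:
  assumes "has_dim S T W (card T)"
  shows "contains_box T W"
proof -
  obtain e C where e: "bij_betw e {..<card T} T" "cell S (card T) (card T) C"
      "C \<subseteq> reindex e (card T) ` W" "W \<subseteq> RR T"
    using assms unfolding has_dim_def contains_cell_def definable_def by blast
  have "contains_box {..<card T} C"
    using cell_full_dim_openin[OF e(2)] contains_box_if_openin by blast
  then have "contains_box {..<card T} (reindex e (card T) ` W)"
    using e(3) by (rule contains_box_mono)
  from contains_box_reindex[OF e(1) this e(4)] show ?thesis .
qed

text \<open>Read through any enumeration of \<open>T\<close>, the box is a cell of dimension
  \<open>card T\<close>, and no cell in that many coordinates has larger dimension.\<close>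

lemma has_dim_if_contains_box:
  assumes "o_minimal S" "definable S T W" "contains_box T W"
  shows "has_dim S T W (card T)"
proof -
  have "finite T" using assms(2) unfolding definable_def by blast
  then obtain e where e: "bij_betw e {..<card T} T"
    using ex_bij_betw_nat_finite[of T] by (auto simp: atLeast0LessThan)
  obtain a b where ab: "\<forall>i\<in>T. a i < b i" "(\<Pi>\<^sub>E i\<in>T. {a i<..<b i}) \<subseteq> W"
    using assms(3) unfolding contains_box_def by blast
  have eT: "e m \<in> T" if "m < card T" for m
    using e that by (auto simp: bij_betw_def)
  have "cell S (card T) (card T) (\<Pi>\<^sub>E m\<in>{..<card T}. {a (e m)<..<b (e m)})"
    using assms(1) ab(1) eT by (intro cell_open_box) auto
  moreover have "(\<Pi>\<^sub>E m\<in>{..<card T}. {a (e m)<..<b (e m)}) \<subseteq> reindex e (card T) ` W"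
  proof
    fix z assume z: "z \<in> (\<Pi>\<^sub>E m\<in>{..<card T}. {a (e m)<..<b (e m)})"
    define w where "w = (\<lambda>i\<in>T. z (inv_into {..<card T} e i))"
    have d: "inv_into {..<card T} e i < card T" "e (inv_into {..<card T} e i) = i" if "i \<in> T" for i
      using e that inv_into_into[of i e "{..<card T}"] by (auto simp: bij_betw_def f_inv_into_f)
    have "w \<in> (\<Pi>\<^sub>E i\<in>T. {a i<..<b i})"
    proof (intro PiE_I)
      fix i assume "i \<in> T"
      then show "w i \<in> {a i<..<b i}"
        using PiE_mem[OF z, of "inv_into {..<card T} e i"] d[of i] by (simp add: w_def)
    qed (simp add: w_def)
    moreover have "reindex e (card T) w = z"
      using z e eT by (auto simp: reindex_def w_def restrict_def bij_betw_def PiE_def extensional_def)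
    ultimately show "z \<in> reindex e (card T) ` W"
      using ab(2) by blast
  qed
  ultimately have "contains_cell S T W (card T)"
    unfolding contains_cell_def using e by blast
  then show ?thesis
    using assms(2) cell_dim_le by (auto simp: has_dim_def contains_cell_def)
qed

section \<open>Basis sets of monotone maps\<close>

text \<open>Inside a box contained in \<open>X\<close> two points are joined by changing one
  coordinate at a time without leaving \<open>X\<close>, so \<open>f\<close> is locally constant.
  Connectedness of \<open>X\<close> makes it constant.\<close>

lemma independent_of_constant:
  assumes I: "finite I" and X: "openin (powertop_real I) X" "connectedin (powertop_real I) X"
    and ind: "\<And>j. j \<in> I \<Longrightarrow> independent_of I X f j"
    and xy: "x \<in> X" "y \<in> X"
  shows "f x = f y"
proof -
  have loc: "f v = f u"
    if box: "u \<in> (\<Pi>\<^sub>E i\<in>I. {a i<..<b i})" "v \<in> (\<Pi>\<^sub>E i\<in>I. {a i<..<b i})"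
      "(\<Pi>\<^sub>E i\<in>I. {a i<..<b i}) \<subseteq> X" for u v a b
  proof -
    \<comment> \<open>\<open>override_on u v J\<close> takes its coordinates in \<open>J\<close>
      from \<open>v\<close> and the others from \<open>u\<close>. It stays in the box, and enlarging
      \<open>J\<close> by one label changes at most one coordinate.\<close>
    have mem: "override_on u v J \<in> X" for J
    proof (rule subsetD[OF box(3)], rule PiE_I)
      show "override_on u v J i \<in> {a i<..<b i}" if "i \<in> I" for i
        using PiE_mem[OF box(1) that] PiE_mem[OF box(2) that] by (cases "i \<in> J") simp_all
      show "override_on u v J i = undefined" if "i \<notin> I" for i
        using PiE_arb[OF box(1) that] PiE_arb[OF box(2) that] by (cases "i \<in> J") simp_all
    qed
    have "f (override_on u v J) = f u" if "finite J" "J \<subseteq> I" for J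
      using that
    proof (induction J)
      case (insert j J)
      let ?p = "override_on u v J" and ?q = "override_on u v (insert j J)"
      have other: "?p l = ?q l" if "l \<noteq> j" for l
        using that by (simp add: override_on_def)
      have at_j: "?p j = u j" "?q j = v j"
        using insert.hyps by simp_all
      \<comment> \<open>\<open>differ_only\<close> orders its two points by the coordinate
        \<open>j\<close>, so the order of \<open>u j\<close> and \<open>v j\<close> decides which
        point comes first.\<close>
      have "f ?p = f ?q"
      proof (cases "u j" "v j" rule: linorder_cases)
        case less
        then have "differ_only I j ?p ?q"
          unfolding differ_only_def at_j using other by blast
        then show ?thesis
          using ind[of j] insert.prems mem unfolding independent_of_def by blast
      next
        case equal
        then have "?p = ?q"
          using other at_j by (metis ext)
        then show ?thesis by (rule arg_cong)
      next
        case greater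
        then have "differ_only I j ?q ?p"
          unfolding differ_only_def at_j using other by fastforce
        then show ?thesis
          using ind[of j] insert.prems mem unfolding independent_of_def by force
      qed
      then show ?case using insert by simp
    qed simp
    from this[OF I] have "f (override_on u v I) = f u" by simp
    moreover have "override_on u v I = v"
    proof
      show "override_on u v I i = v i" for i
        using PiE_arb[OF box(1)] PiE_arb[OF box(2)] by (cases "i \<in> I") simp_all
    qed
    ultimately show ?thesis by simp
  qed
  \<comment> \<open>Local constancy makes every set described by a condition on the value of
    \<open>f\<close> open. Used for equality with \<open>f x\<close> and for its negation, this
    splits \<open>X\<close> into two open parts.\<close>
  have open_level: "openin (powertop_real I) {z \<in> X. P (f z)}" for P
    unfolding openin_subopen[of _ "{z \<in> X. P (f z)}"]
  proof
    fix u assume u: "u \<in> {z \<in> X. P (f z)}"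
    then obtain a b where ab: "u \<in> (\<Pi>\<^sub>E i\<in>I. {a i<..<b i})" "(\<Pi>\<^sub>E i\<in>I. {a i<..<b i}) \<subseteq> X"
      using openin_powertop_real_box[OF X(1)] by blast
    have "openin (powertop_real I) (\<Pi>\<^sub>E i\<in>I. {a i<..<b i})"
      using I by (simp add: openin_PiE)
    moreover have "(\<Pi>\<^sub>E i\<in>I. {a i<..<b i}) \<subseteq> {z \<in> X. P (f z)}"
    proof
      fix v assume v: "v \<in> (\<Pi>\<^sub>E i\<in>I. {a i<..<b i})"
      have "f v = f u"
        by (rule loc[OF ab(1) v ab(2)])
      then show "v \<in> {z \<in> X. P (f z)}"
        using u v ab(2) by auto
    qed
    ultimately show "\<exists>V. openin (powertop_real I) V \<and> u \<in> V \<and> V \<subseteq> {z \<in> X. P (f z)}"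
      using ab(1) by (intro exI conjI)
  qed
  show ?thesis
  proof (rule ccontr)
    assume "f x \<noteq> f y"
    then have "{z \<in> X. f z = f x} \<inter> X \<noteq> {}" "{z \<in> X. f z \<noteq> f x} \<inter> X \<noteq> {}"
      using xy by auto
    then show False
      by (rule connectedinD[OF X(2) open_level[of "\<lambda>t. t = f x"] open_level[of "\<lambda>t. t \<noteq> f x"],
            rotated 2]) auto
  qed
qed

text \<open>The whole space is the coordinate cone with an empty set of conditions.\<close>

lemma semi_monotone_connectedin:
  assumes "semi_monotone S I X"
  shows "connectedin (powertop_real I) X"
proof -
  have "X \<subseteq> RR I"
    using assms openin_subset[of "powertop_real I" X] by (simp add: semi_monotone_def)
  moreover have "coordinate_cone I (RR I)"
    unfolding coordinate_cone_def by (intro exI[of _ "{}"]) auto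
  ultimately show ?thesis
    using assms unfolding semi_monotone_def by (metis inf.absorb1)
qed

text \<open>A point of the graph is determined by its domain coordinates. This translates between
  \<open>quasi_affine\<close>, which speaks of the graph, and \<open>basis_sets\<close>, which
  speaks of the domain.\<close>

lemma inj_on_restrict_graph_iff:
  assumes "A \<inter> B = {}" "X \<subseteq> RR A"
  shows "inj_on (\<lambda>z. restrict z T) (graph_of A B X f)
    \<longleftrightarrow> inj_on (\<lambda>x. restrict (merge A B (x, f x)) T) X"
proof -
  have "inj_on (\<lambda>x. merge A B (x, f x)) X"
  proof (rule inj_onI)
    fix x y assume xy: "x \<in> X" "y \<in> X" "merge A B (x, f x) = merge A B (y, f y)"
    have "x i = y i" if "i \<in> A" for i
      using fun_cong[OF xy(3), of i] that assms(1) by simp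
    then show "x = y"
      using xy assms(2) by (intro PiE_ext[of x A "\<lambda>_. UNIV" y]) auto
  qed
  then show ?thesis
    unfolding graph_of_def by (simp add: comp_inj_on_iff o_def)
qed

section \<open>Boxes in projections of graphs and of slices\<close>

lemma contains_box_not_constant:
  assumes "contains_box T W" "i \<in> T"
  obtains w w' where "w \<in> W" "w' \<in> W" "w i \<noteq> w' i"
proof -
  obtain a b where ab: "\<And>i. i \<in> T \<Longrightarrow> a i < b i" "(\<Pi>\<^sub>E i\<in>T. {a i<..<b i}) \<subseteq> W"
    using assms(1) unfolding contains_box_def by blast
  \<comment> \<open>Proper convex combinations of the two corners lie in the open box. The weights
    1/2 and 1/3 give points that differ in every coordinate in \<open>T\<close>.\<close>
  have mem: "(\<lambda>l\<in>T. c * a l + (1 - c) * b l) \<in> W" if c: "0 < c" "c < 1" for c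
  proof (rule subsetD[OF ab(2)], intro PiE_I)
    fix l assume l: "l \<in> T"
    have "c * a l < c * b l" "(1 - c) * a l < (1 - c) * b l"
      using ab(1)[OF l] c by auto
    then show "(\<lambda>l\<in>T. c * a l + (1 - c) * b l) l \<in> {a l<..<b l}"
      using l by (simp add: algebra_simps)
  qed simp
  show ?thesis
    using that[OF mem[of "1/2"] mem[of "1/3"]] ab(1)[OF assms(2)] assms(2) by simp
qed

lemma graph_projection_not_constant:
  assumes "contains_box T ((\<lambda>z. restrict z T) ` graph_of A B X f)" "A \<inter> B = {}" "i \<in> T" "i \<in> B"
  obtains u v where "u \<in> X" "v \<in> X" "f u i \<noteq> f v i"
proof -
  obtain w w' where w: "w \<in> (\<lambda>z. restrict z T) ` graph_of A B X f"
      "w' \<in> (\<lambda>z. restrict z T) ` graph_of A B X f" "w i \<noteq> w' i"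
    by (rule contains_box_not_constant[OF assms(1,3)])
  obtain u v where "u \<in> X" "v \<in> X" "w = restrict (merge A B (u, f u)) T"
      "w' = restrict (merge A B (v, f v)) T"
    using w(1,2) unfolding graph_of_def by blast
  with w(3) assms(2-4) show ?thesis
    using that[of u v] by simp
qed

text \<open>Fixing the coordinate \<open>i\<close> of a box at an interior value of its
  \<open>i\<close>-th side leaves the box formed by the other sides.\<close>

lemma contains_box_slice:
  assumes "contains_box T ((\<lambda>z. restrict z T) ` F)" "i \<in> T" "T \<subseteq> I"
  obtains b where "contains_box (T - {i}) ((\<lambda>z. restrict z (T - {i})) ` slice I F i b)"
    "slice I F i b \<noteq> {}"
proof -
  obtain a b where ab: "\<And>i. i \<in> T \<Longrightarrow> a i < b i"
      "(\<Pi>\<^sub>E i\<in>T. {a i<..<b i}) \<subseteq> (\<lambda>z. restrict z T) ` F"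
    using assms(1) unfolding contains_box_def by blast
  let ?c = "(a i + b i) / 2"
  have sub: "(\<Pi>\<^sub>E i\<in>T - {i}. {a i<..<b i}) \<subseteq> (\<lambda>z. restrict z (T - {i})) ` slice I F i ?c"
  proof
    fix w assume w: "w \<in> (\<Pi>\<^sub>E i\<in>T - {i}. {a i<..<b i})"
    have "w(i := ?c) \<in> (\<Pi>\<^sub>E i\<in>T. {a i<..<b i})"
    proof (rule PiE_I)
      show "(w(i := ?c)) l \<in> {a l<..<b l}" if "l \<in> T" for l
        using PiE_mem[OF w, of l] that ab(1)[OF assms(2)] by (cases "l = i") simp_all
      show "(w(i := ?c)) l = undefined" if "l \<notin> T" for l
        using PiE_arb[OF w, of l] that assms(2) by auto
    qed
    then obtain z where z: "z \<in> F" "w(i := ?c) = restrict z T"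
      using ab(2) by blast
    have "z l = w l" if "l \<in> T - {i}" for l
      using fun_cong[OF z(2), of l] that by auto
    moreover have "z i = ?c"
      using fun_cong[OF z(2), of i] assms(2) by simp
    ultimately have "restrict z (I - {i}) \<in> slice I F i ?c" "w = restrict (restrict z (I - {i})) (T - {i})"
      using w z(1) assms(3) unfolding slice_def
      by (auto simp: restrict_def PiE_def extensional_def fun_eq_iff)
    then show "w \<in> (\<lambda>z. restrict z (T - {i})) ` slice I F i ?c" by blast
  qed
  \<comment> \<open>The remaining box is never empty: its centre exists even when
    \<open>T = {i}\<close>, where it is the only point.\<close>
  have "\<exists>w. w \<in> (\<Pi>\<^sub>E i\<in>T - {i}. {a i<..<b i})"
    using ab(1) by (intro exI[of _ "\<lambda>l\<in>T - {i}. (a l + b l) / 2"]) (auto simp: field_simps)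
  then have "slice I F i ?c \<noteq> {}"
    using sub by blast
  moreover have "contains_box (T - {i}) ((\<lambda>z. restrict z (T - {i})) ` slice I F i ?c)"
    unfolding contains_box_def using ab(1) sub by blast
  ultimately show ?thesis using that by blast
qed

lemma is_monotone_mapD:
  assumes "is_monotone_map S A B X f"
  shows "X \<noteq> {}" "finite A" "semi_monotone S A X" "X \<subseteq> RR A"
    "bounded_continuous_definable_map S A B X f"
proof -
  show "X \<noteq> {}" "finite A" and sm: "semi_monotone S A X"
    and "bounded_continuous_definable_map S A B X f"
    using assms by (cases; auto intro: card_ge_0_finite)+
  from sm show "X \<subseteq> RR A"
    using openin_subset[of "powertop_real A" X] by (simp add: semi_monotone_def)
qed

text \<open>\<open>T\<close> is kept arbitrary in the induction because the slice maps are treated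
  with \<open>T - {i}\<close> in its place.\<close>

lemma monotone_map_projection_inj:
  assumes "is_monotone_map S A B X f" "A \<inter> B = {}" "T \<subseteq> A \<union> B" "card T = card A"
    "contains_box T ((\<lambda>z. restrict z T) ` graph_of A B X f)"
  shows "inj_on (\<lambda>z. restrict z T) (graph_of A B X f)"
  using assms
proof (induction arbitrary: T rule: is_monotone_map.induct)
  case (one A X B f)
  obtain j where j: "A = {j}" using one.hyps(1) by (auto simp: card_1_singleton_iff)
  obtain i where i: "T = {i}" using one by (auto simp: card_1_singleton_iff)
  then have iT: "i \<in> T" by simp
  have XR: "X \<subseteq> RR A"
    using one.hyps(3) openin_subset[of "powertop_real A" X] by (simp add: semi_monotone_def)
  show ?case
    unfolding inj_on_restrict_graph_iff[OF one.prems(1) XR]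
  proof (rule inj_onI)
    fix x y assume xy: "x \<in> X" "y \<in> X"
      and "restrict (merge A B (x, f x)) T = restrict (merge A B (y, f y)) T"
    then have eq: "merge A B (x, f x) i = merge A B (y, f y) i"
      using i by (metis restrict_apply insertI1)
    have j_eq: "u = v" if "u \<in> X" "v \<in> X" "u j = v j" for u v
      using that XR j by (intro PiE_ext[of u A "\<lambda>_. UNIV" v]) auto
    \<comment> \<open>On a line any two distinct points are comparable, so the one-coordinate
      conditions on \<open>f\<close> apply to every pair.\<close>
    have lin: "u = v \<or> differ_only A j u v \<or> differ_only A j v u" if "u \<in> X" "v \<in> X" for u v
      using j_eq[OF that] unfolding differ_only_def j by force
    show "x = y"
    proof (cases "i \<in> A")
      case True
      then show ?thesis using eq one.prems(1) j j_eq[OF xy] by auto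
    next
      case False
      then have iB: "i \<in> B" using i one.prems(2) by auto
      then have feq: "f x i = f y i"
        using eq one.prems(1) by simp
      \<comment> \<open>Independence of the only coordinate would make \<open>f\<close> constant in
        its component \<open>i\<close>, against the box in the projection. Strict monotonicity is
        what remains.\<close>
      have "\<not> independent_of A X (\<lambda>x. f x i) j"
      proof
        assume "independent_of A X (\<lambda>x. f x i) j"
        then have "f u i = f v i" if "u \<in> X" "v \<in> X" for u v
          using lin[OF that] that unfolding independent_of_def by metis
        moreover obtain u v where "u \<in> X" "v \<in> X" "f u i \<noteq> f v i"
          by (rule graph_projection_not_constant[OF one.prems(4) one.prems(1) iT iB])
        ultimately show False by blast
      qed
      then have "strictly_increasing_in A X (\<lambda>x. f x i) j \<or> strictly_decreasing_in A X (\<lambda>x. f x i) j"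
        using one.hyps(5) iB j unfolding monotone_function_def by blast
      then show ?thesis
        using lin[OF xy] xy feq unfolding strictly_increasing_in_def strictly_decreasing_in_def
        by (metis less_irrefl)
    qed
  qed
next
  case (step A X B f)
  let ?F = "graph_of A B X f" and ?I = "A \<union> B"
  have fin: "finite A" using step.hyps(1) by (intro card_ge_0_finite) simp
  have XA: "openin (powertop_real A) X"
    using step.hyps(3) by (simp add: semi_monotone_def)
  then have XR: "X \<subseteq> RR A" using openin_subset by fastforce
  show ?case
  proof (cases "T = A")
    case True
    have "inj_on (\<lambda>x. restrict (merge A B (x, f x)) A) X"
    proof (rule inj_onI)
      fix x y assume xy: "x \<in> X" "y \<in> X"
        and "restrict (merge A B (x, f x)) A = restrict (merge A B (y, f y)) A"
      then have "x l = y l" if "l \<in> A" for l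
        using that step.prems(1) by (metis merge_apply(1) restrict_apply')
      then show "x = y" using xy XR by (intro PiE_ext[of x A "\<lambda>_. UNIV" y]) auto
    qed
    then show ?thesis
      using True inj_on_restrict_graph_iff[OF step.prems(1) XR] by metis
  next
    case False
    \<comment> \<open>A subset of \<open>A\<close> with \<open>card A\<close> elements is
      \<open>A\<close> itself, so \<open>T\<close> must contain a target coordinate.\<close>
    then have "\<not> T \<subseteq> A"
      using card_subset_eq[OF fin] step.prems(3) by blast
    then obtain i where i: "i \<in> T" "i \<in> B" "i \<notin> A"
      using step.prems(1,2) by blast
    have "\<exists>j\<in>A. \<not> independent_of A X (\<lambda>x. f x i) j"
    proof (rule ccontr)
      assume "\<not> (\<exists>j\<in>A. \<not> independent_of A X (\<lambda>x. f x i) j)"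
      then have "f u i = f v i" if "u \<in> X" "v \<in> X" for u v
        using independent_of_constant[OF fin XA semi_monotone_connectedin[OF step.hyps(3)], of "\<lambda>x. f x i"] that
        by blast
      moreover obtain u v where "u \<in> X" "v \<in> X" "f u i \<noteq> f v i"
        by (rule graph_projection_not_constant[OF step.prems(4) step.prems(1) i(1) i(2)])
      ultimately show False by blast
    qed
    then obtain j where j: "j \<in> A" "\<not> independent_of A X (\<lambda>x. f x i) j" by blast
    let ?A = "A - {j}" and ?B = "insert j (B - {i})" and ?T = "T - {i}"
    \<comment> \<open>The rule supplies one pair \<open>Y\<close>, \<open>g\<close> for all
      \<open>b\<close>. The slice equation, the monotonicity, the induction hypothesis and the
      independence of \<open>b\<close> must be extracted for this same pair.\<close>
    obtain Y g where Yg: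
      "\<And>b. slice ?I ?F i b \<noteq> {} \<Longrightarrow> slice ?I ?F i b = graph_of ?A ?B (Y b) (g b)"
      "\<And>b. slice ?I ?F i b \<noteq> {} \<Longrightarrow> is_monotone_map S ?A ?B (Y b) (g b)"
      "\<And>b T. slice ?I ?F i b \<noteq> {} \<Longrightarrow> T \<subseteq> ?A \<union> ?B \<Longrightarrow> card T = card ?A \<Longrightarrow>
        contains_box T ((\<lambda>z. restrict z T) ` graph_of ?A ?B (Y b) (g b)) \<Longrightarrow>
        inj_on (\<lambda>z. restrict z T) (graph_of ?A ?B (Y b) (g b))"
      "\<And>b b'. slice ?I ?F i b \<noteq> {} \<Longrightarrow> slice ?I ?F i b' \<noteq> {} \<Longrightarrow>
        basis_sets ?A ?B (Y b) (g b) = basis_sets ?A ?B (Y b') (g b')"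
    proof -
      have disj: "?A \<inter> ?B = {}" using step.prems(1) by blast
      from step.IH[rule_format, OF i(2) j] show ?thesis
        apply (elim exE conjE)
        subgoal for Y g
          using disj by (intro that[of Y g]) blast+
        done
    qed
    \<comment> \<open>Trading \<open>i\<close> for \<open>j\<close> leaves the labels
      \<open>A \<union> B\<close> without \<open>i\<close>, and removing \<open>i\<close> from
      \<open>T\<close> and \<open>j\<close> from \<open>A\<close> lowers both cardinalities by
      one.\<close>
    have disj: "?A \<inter> ?B = {}" and T: "?T \<subseteq> ?A \<union> ?B" "card ?T = card ?A"
      using step.prems i j by (auto simp: card_Diff_singleton_if)
    \<comment> \<open>Expressed through basis sets, injectivity on a slice becomes a property that
      does not depend on \<open>b\<close>.\<close>
    have basis_iff: "?T \<in> basis_sets ?A ?B (Y b) (g b) \<longleftrightarrow> inj_on (\<lambda>z. restrict z ?T) (slice ?I ?F i b)"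
      if "slice ?I ?F i b \<noteq> {}" for b
      unfolding Yg(1)[OF that] inj_on_restrict_graph_iff[OF disj is_monotone_mapD(4)[OF Yg(2)[OF that]]]
      using T by (simp add: basis_sets_def)
    obtain b0 where b0: "contains_box ?T ((\<lambda>z. restrict z ?T) ` slice ?I ?F i b0)"
        "slice ?I ?F i b0 \<noteq> {}"
      using contains_box_slice[OF step.prems(4) i(1) step.prems(2)] by blast
    \<comment> \<open>The induction hypothesis is applied at the single value \<open>b0\<close>, the
      only one at which a box is at hand; the common system of basis sets carries the result to all
      non-empty slices.\<close>
    have "inj_on (\<lambda>z. restrict z ?T) (slice ?I ?F i b0)"
      using Yg(3)[OF b0(2) T] b0 Yg(1)[OF b0(2)] by simp
    then have inj: "inj_on (\<lambda>z. restrict z ?T) (slice ?I ?F i b)" if "slice ?I ?F i b \<noteq> {}" for b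
      using basis_iff[OF b0(2)] basis_iff[OF that] Yg(4)[OF b0(2) that] by simp
    show ?thesis
    proof (rule inj_onI)
      fix z z' assume z: "z \<in> ?F" "z' \<in> ?F" and eq: "restrict z T = restrict z' T"
      have T_eq: "z l = z' l" if "l \<in> T" for l
        using fun_cong[OF eq, of l] that by simp
      \<comment> \<open>As \<open>i \<in> T\<close>, points with the same projection to
        \<open>T\<close> have the same coordinate \<open>i\<close> and hence lie over the same
        slice.\<close>
      have mem: "restrict z (?I - {i}) \<in> slice ?I ?F i (z i)" "restrict z' (?I - {i}) \<in> slice ?I ?F i (z i)"
        unfolding slice_def using z T_eq[OF i(1)] by (auto intro!: exI)
      have "restrict (restrict z (?I - {i})) ?T = restrict (restrict z' (?I - {i})) ?T"
        using T_eq by (auto simp: restrict_def)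
      then have slice_eq: "restrict z (?I - {i}) = restrict z' (?I - {i})"
        using inj[of "z i"] mem by (metis (no_types, lifting) empty_iff inj_onD)
      have "z l = z' l" if "l \<in> ?I" for l
        using that T_eq[OF i(1)] fun_cong[OF slice_eq, of l] by (cases "l = i") auto
      moreover have "z l = z' l" if "l \<notin> ?I" for l
        using z that by (auto simp: graph_of_def)
      ultimately show "z = z'" by (intro ext) blast
    qed
  qed
qed

section \<open>Invariance of domain\<close>

text \<open>This is invariance of domain, transported from \<open>Euclidean_space n\<close> to
  spaces with arbitrary finite sets of labels; an open non-empty image contains a box.\<close>

lemma injective_image_contains_box:
  assumes A: "finite A" and T: "card T = card A" "finite T"
    and X: "openin (powertop_real A) X" "X \<noteq> {}"
    and h: "continuous_map (subtopology (powertop_real A) X) (powertop_real T) h" "inj_on h X"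
  shows "contains_box T (h ` X)"
proof -
  define n where "n = card A"
  obtain e where e: "bij_betw e {..<n} A"
    using ex_bij_betw_nat_finite[OF A] by (auto simp: atLeast0LessThan n_def)
  obtain e' where e': "bij_betw e' {..<n} T"
    using ex_bij_betw_nat_finite[OF T(2)] T(1) by (auto simp: atLeast0LessThan n_def)
  have e'T: "e' m \<in> T" and eA: "e m \<in> A" if "m < n" for m
    using e e' that by (auto simp: bij_betw_def)
  define d where "d = inv_into {..<n} e"
  have d: "d i < n" "e (d i) = i" if "i \<in> A" for i
    using e that inv_into_into[of i e "{..<n}"] by (auto simp: bij_betw_def f_inv_into_f d_def)
  have de: "d (e m) = m" if "m < n" for m
    using e that by (auto simp: bij_betw_def d_def)
  \<comment> \<open>\<open>p\<close> renames coordinates to the labels in \<open>A\<close>, and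
    \<open>q\<close> renames labels in \<open>T\<close> to numbers. Points of
    \<open>Euclidean_space n\<close> vanish from coordinate \<open>n\<close> on, whence the default
    0 in \<open>q\<close>.\<close>
  define p :: "(nat \<Rightarrow> real) \<Rightarrow> 'a \<Rightarrow> real" where "p z = (\<lambda>i\<in>A. z (d i))" for z
  define q :: "('b \<Rightarrow> real) \<Rightarrow> nat \<Rightarrow> real" where "q y = (\<lambda>m. if m < n then y (e' m) else 0)" for y
  let ?E = "Euclidean_space n"
  have p: "continuous_map ?E (powertop_real A) p"
    unfolding p_def Euclidean_space_def
    by (auto simp: continuous_map_componentwise
        intro!: continuous_map_from_subtopology continuous_map_product_projection)
  have q: "continuous_map (powertop_real T) ?E q"
    unfolding q_def using e'T
    by (auto simp: continuous_map_componentwise_Euclidean_space intro!: continuous_map_product_projection)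
  define U where "U = {z \<in> topspace ?E. p z \<in> X}"
  have U: "openin ?E U"
    unfolding U_def using p X(1) by (rule openin_continuous_map_preimage)
  have pU: "p ` U = X"
  proof (intro equalityI subsetI)
    fix x assume x: "x \<in> X"
    then have xA: "x \<in> RR A" using openin_subset[OF X(1)] by auto
    let ?z = "\<lambda>m. if m < n then x (e m) else 0"
    have "p ?z = x"
      using xA d by (auto simp: p_def PiE_def extensional_def fun_eq_iff)
    moreover from this x have "?z \<in> U"
      by (simp add: U_def topspace_Euclidean_space)
    ultimately show "x \<in> p ` U" by (metis imageI)
  qed (auto simp: U_def)
  have inj_p: "inj_on p U"
  proof (rule inj_onI)
    fix y z assume yz: "y \<in> U" "z \<in> U" "p y = p z"
    have "y m = z m" for m
    proof (cases "m < n")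
      case True
      then show ?thesis using fun_cong[OF yz(3), of "e m"] eA de by (simp add: p_def)
    next
      case False
      then show ?thesis using yz by (simp add: U_def topspace_Euclidean_space)
    qed
    then show "y = z" by blast
  qed
  have inj_q: "inj_on q (RR T)"
  proof (rule inj_onI)
    fix y z assume yz: "y \<in> RR T" "z \<in> RR T" "q y = q z"
    have "y i = z i" if "i \<in> T" for i
    proof -
      have "i \<in> e' ` {..<n}" using bij_betw_imp_surj_on[OF e'] that by simp
      then obtain m where "m < n" "i = e' m" by blast
      then show ?thesis using fun_cong[OF yz(3), of m] by (simp add: q_def)
    qed
    then show "y = z" using yz by (intro PiE_ext[of y T "\<lambda>_. UNIV" z]) auto
  qed
  have hX: "h ` X \<subseteq> RR T"
    using continuous_map_image_subset_topspace[OF h(1)] openin_subset[OF X(1)]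
    by (simp add: inf.absorb2)
  have pU': "continuous_map (subtopology ?E U) (subtopology (powertop_real A) X) p"
    using p pU by (auto simp: continuous_map_in_subtopology continuous_map_from_subtopology)
  have "continuous_map (subtopology ?E U) ?E (q \<circ> (h \<circ> p))"
    using pU' h(1) q by (intro continuous_map_compose)
  moreover have "inj_on (q \<circ> (h \<circ> p)) U"
  proof (intro comp_inj_on inj_p)
    show "inj_on h (p ` U)"
      using h(2) pU by simp
    show "inj_on q ((h \<circ> p) ` U)"
      using inj_on_subset[OF inj_q hX] by (simp only: image_comp[symmetric] pU)
  qed
  ultimately have "openin ?E ((q \<circ> (h \<circ> p)) ` U)"
    using U invariance_of_domain_Euclidean_space by blast
  then have op: "openin ?E (q ` h ` X)"
    by (simp only: image_comp[symmetric] pU)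
  have "openin (powertop_real T) {y \<in> topspace (powertop_real T). q y \<in> q ` h ` X}"
    using q op by (rule openin_continuous_map_preimage)
  moreover have "{y \<in> topspace (powertop_real T). q y \<in> q ` h ` X} = h ` X"
  proof (intro equalityI subsetI)
    fix y assume "y \<in> {y \<in> topspace (powertop_real T). q y \<in> q ` h ` X}"
    then have "y \<in> RR T" "q y \<in> q ` h ` X" by simp_all
    then show "y \<in> h ` X"
      using inj_on_image_mem_iff[OF inj_q _ hX] by blast
  next
    fix y assume "y \<in> h ` X"
    moreover from this have "y \<in> RR T" by (rule subsetD[OF hX])
    ultimately show "y \<in> {y \<in> topspace (powertop_real T). q y \<in> q ` h ` X}"
      by simp
  qed
  ultimately have "openin (powertop_real T) (h ` X)"
    by (rule back_subst)
  then show ?thesis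
    using X(2) by (intro contains_box_if_openin) simp_all
qed

lemma graph_projection_contains_box:
  assumes A: "finite A" "A \<inter> B = {}" and X: "openin (powertop_real A) X" "X \<noteq> {}"
    and f: "continuous_map (subtopology (powertop_real A) X) (powertop_real B) f"
    and T: "T \<subseteq> A \<union> B" "card T = card A" "finite T"
    and inj: "inj_on (\<lambda>z. restrict z T) (graph_of A B X f)"
  shows "contains_box T ((\<lambda>z. restrict z T) ` graph_of A B X f)"
proof -
  have XR: "X \<subseteq> RR A" using openin_subset[OF X(1)] by simp
  let ?h = "\<lambda>x. restrict (merge A B (x, f x)) T"
  \<comment> \<open>Each component of the projection is either a coordinate of \<open>x\<close> or a
    component of \<open>f\<close>, and both are continuous.\<close>
  have comp: "continuous_map (subtopology (powertop_real A) X) euclideanreal (\<lambda>x. merge A B (x, f x) i)"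
    if "i \<in> T" for i
  proof (cases "i \<in> A")
    case True
    then show ?thesis
      using A(2) continuous_map_product_projection[of i A "\<lambda>_. euclideanreal"]
      by (simp add: continuous_map_from_subtopology)
  next
    case False
    then have "i \<in> B" using T(1) that by blast
    then show ?thesis
      using f A(2) by (simp add: continuous_map_componentwise)
  qed
  then have "continuous_map (subtopology (powertop_real A) X) (powertop_real T) ?h"
    by (auto simp: continuous_map_componentwise)
  moreover have "inj_on ?h X"
    using inj inj_on_restrict_graph_iff[OF A(2) XR] by metis
  ultimately have "contains_box T (?h ` X)"
    using A T X by (intro injective_image_contains_box)
  then show ?thesis
    by (simp add: graph_of_def image_image)
qed

text \<open>Both directions pass through boxes: invariance of domain produces one from injectivity,
  and the induction over slices yields injectivity from one. Definability of the projection turns a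
  box into full dimension.\<close>

lemma quasi_affine_if_monotone_map:
  assumes S: "o_minimal S" and "finite B" and AB: "A \<inter> B = {}" and f: "is_monotone_map S A B X f"
  shows "quasi_affine S A B X f"
proof -
  note basic = is_monotone_mapD[OF f]
  have X: "openin (powertop_real A) X" "bounded_on A X" "definable S A X"
    using basic(3) by (auto simp: semi_monotone_def)
  have cont: "continuous_map (subtopology (powertop_real A) X) (powertop_real B) f"
    and def: "definable S (A \<union> B) (graph_of A B X f)"
    using basic(5) by (auto simp: bounded_continuous_definable_map_def)
  have "inj_on (\<lambda>z. restrict z T) (graph_of A B X f)
      \<longleftrightarrow> has_dim S T ((\<lambda>z. restrict z T) ` graph_of A B X f) (card A)"
    if T: "T \<subseteq> A \<union> B" "card T = card A" for T
  proof
    assume inj: "inj_on (\<lambda>z. restrict z T) (graph_of A B X f)"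
    have "finite T"
      using T(1) basic(2) \<open>finite B\<close> finite_subset by blast
    then have "contains_box T ((\<lambda>z. restrict z T) ` graph_of A B X f)"
      using graph_projection_contains_box basic(1,2) AB X(1) cont T inj by blast
    then show "has_dim S T ((\<lambda>z. restrict z T) ` graph_of A B X f) (card A)"
      using has_dim_if_contains_box[OF S definable_restrict_image[OF S def T(1)]] T(2) by simp
  next
    assume "has_dim S T ((\<lambda>z. restrict z T) ` graph_of A B X f) (card A)"
    then show "inj_on (\<lambda>z. restrict z T) (graph_of A B X f)"
      using monotone_map_projection_inj[OF f AB T] contains_box_if_has_dim T(2) by metis
  qed
  then show ?thesis
    unfolding quasi_affine_def using basic X by blast
qed

theorem theorem3p19:
  fixes S :: set_family and n k :: nat
    and X :: "(coord \<Rightarrow> real) set" and f :: "(coord \<Rightarrow> real) \<Rightarrow> (coord \<Rightarrow> real)"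
  assumes "o_minimal S"
    and "n \<ge> 1"
    and "X \<noteq> {}" and "semi_monotone S (XC ` {1..n}) X"
    and "is_monotone_map S (XC ` {1..n}) (YC ` {1..k}) X f"
  shows "quasi_affine S (XC ` {1..n}) (YC ` {1..k}) X f"
  using assms by (intro quasi_affine_if_monotone_map) auto

end
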